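(* Let $d\geq 2$ be an integer. There exists a set $K\subset \mathbb{R}^d$ such that (i) $K$ is compact; (ii) $K$ asymptotically and omnidirectionally contains arithmetic progressions, i.e. for all integers $k\geq 3$, all $\varepsilon\in(0,1)$ and all $e\in S^{d-1}$ there exists a $(k,\varepsilon,\{e\})$-AP $Q\subset\mathbb{R}^d$ with $Q\subseteq K$; (iii) $\dim_{\mathrm{A}} K=1$.
   Context: $\|\cdot\|$ is the Euclidean norm on $\mathbb{R}^d$ and $S^{d-1}$ is the unit sphere in $\mathbb{R}^d$. Arithmetic patches. Let $1\leq m\leq d$ be integers and let $\{e_1,\ldots,e_m\}$ be a set of linearly independent vectors in $\mathbb{R}^d$. For $k\in\mathbb{N}$ and $\Delta>0$, a set $P\subset\mathbb{R}^d$ is an arithmetic patch of size $k$ and scale $\Delta$ with respect to orientation $\{e_1,\ldots,e_m\}$ if $$P=\left\{t+\Delta\sum_{i=1}^m x_ie_i \colon x_i=0,1,\ldots,k-1\right\}$$ for some $t\in\mathbb{R}^d$. For $\varepsilon\in[0,1)$, a set $Q\subset\mathbb{R}^d$ is a $(k,\varepsilon,\{e_1,\ldots,e_m\})$-AP if there exists an arithmetic patch $P$ of size $k$ and some scale $\Delta>0$ with respect to orientation $\{e_1,\ldots,e_m\}$ such that $\#Q=\#P$ and $\inf_{y\in Q}\|x-y\|\leq\varepsilon\Delta$ for all $x\in P$. (The case $m=1$ with $e_1=e\in S^{d-1}$ is the one used here.) Assouad dimension. For bounded $E\subset\mathbb{R}^d$ and $r>0$, $N(E,r)$ is the smallest number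 of open sets with diameter at most $r$ required to cover $E$. For $F\subseteq\mathbb{R}^d$, $\dim_{\mathrm{A}}F$ is the infimum of all $\sigma\geq0$ for which there exists $C>0$ such that for all $R>0$, all $r\in(0,R)$ and all $x\in F$, $$N\big(B(x,R)\cap F,r\big)\leq C\left(\frac{R}{r}\right)^{\sigma},$$ where $B(x,R)$ is the closed ball with centre $x$ and radius $R$. *)

theory Defs
  imports "HOL-Analysis.Analysis"
begin

text \<open>
  An orientation is the set \<open>V = {e\<^sub>1, \<dots>, e\<^sub>m}\<close> itself. A coefficient vector \<open>(x\<^sub>1, \<dots>, x\<^sub>m)\<close> is a
  function \<open>x\<close> of which only the values on \<open>V\<close> matter. Independence bounds \<open>m\<close> by the dimension.
\<close>

definition arithmetic_patch ::
  "nat \<Rightarrow> real \<Rightarrow> 'a::euclidean_space set \<Rightarrow> 'a set \<Rightarrow> bool" where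
  "arithmetic_patch k \<Delta> V P \<longleftrightarrow>
     V \<noteq> {} \<and> independent V \<and> \<Delta> > 0 \<and>
     (\<exists>t. P = {t + \<Delta> *\<^sub>R (\<Sum>v\<in>V. real (x v) *\<^sub>R v) | x :: 'a \<Rightarrow> nat. \<forall>v\<in>V. x v < k})"

definition approx_arithmetic_patch ::
  "nat \<Rightarrow> real \<Rightarrow> 'a::euclidean_space set \<Rightarrow> 'a set \<Rightarrow> bool" where
  "approx_arithmetic_patch k \<epsilon> V Q \<longleftrightarrow>
     0 \<le> \<epsilon> \<and> \<epsilon> < 1 \<and>
     (\<exists>P \<Delta>. arithmetic_patch k \<Delta> V P \<and> finite Q \<and> card Q = card P \<and>
            (\<forall>x\<in>P. (INF y\<in>Q. norm (x - y)) \<le> \<epsilon> * \<Delta>))"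

text \<open>
  The real-valued \<^const>\<open>diameter\<close> is unspecified on unbounded sets, so boundedness of the covering
  sets is required explicitly. For bounded \<open>E\<close> and \<open>r > 0\<close> a finite cover always exists.
\<close>

definition covering_number :: "'a::euclidean_space set \<Rightarrow> real \<Rightarrow> nat" where
  "covering_number E r =
     (LEAST n. \<exists>\<U>. finite \<U> \<and> card \<U> = n \<and> E \<subseteq> \<Union>\<U> \<and>
                   (\<forall>U\<in>\<U>. open U \<and> bounded U \<and> diameter U \<le> r))"

text \<open>
  In a Euclidean space the exponent \<open>DIM('a)\<close> is always admissible, so the infimum is over a
  nonempty set of reals that is bounded below by \<open>0\<close>.
\<close>

definition assouad_dim :: "'a::euclidean_space set \<Rightarrow> real" where
  "assouad_dim F =
     Inf {\<sigma>. \<sigma> \<ge> 0 \<and>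
          (\<exists>C>0. \<forall>R>0. \<forall>r\<in>{0<..<R}. \<forall>x\<in>F.
             real (covering_number (cball x R \<inter> F) r) \<le> C * (R / r) powr \<sigma>)}"

end

theory Submission
  imports Defs "HOL-Real_Asymp.Real_Asymp"
begin

text \<open>
  The set is a comb of countably many straight teeth. Fix a unit vector \<open>u\<close> and a sequence
  \<open>v\<^sub>n\<close> that is dense in the unit sphere, and attach to the point \<open>2\<^sup>-\<^sup>n u\<close> of the ray spanned by
  \<open>u\<close> a segment of length \<open>2\<^sup>-\<^sup>n / 6\<close> in the direction \<open>v\<^sub>n\<close>; add the origin, at which the teeth
  accumulate.

  A tooth contains exact progressions of every length in its own direction. Tilting a progression
  of \<open>k\<close> points and scale \<open>\<Delta>\<close> by a small angle moves its points by at most \<open>k \<Delta>\<close> times the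
  distance of the two directions, so density of the \<open>v\<^sub>n\<close> gives approximate progressions in all
  directions (\<open>tooth_contains_patch\<close>).

  The teeth are so short compared with the gaps between their feet that the comb is
  bi-Lipschitz equivalent to a subset of the real line: laying every tooth down along the ray
  changes distances by at most a constant factor (\<open>laid_down_bi_lipschitz\<close>). Covering intervals of
  the line by shorter ones then bounds the dimension by \<open>1\<close>
  (\<open>bi_lipschitz_line_imp_assouad_exponent\<close>). It is at least \<open>1\<close> because a single tooth is already
  a segment (\<open>segment_imp_assouad_exponent_ge_1\<close>).
\<close>

section \<open>Covering numbers and admissible exponents\<close>

definition assouad_exponent :: "'a::euclidean_space set \<Rightarrow> real \<Rightarrow> bool" where
  "assouad_exponent F \<sigma> \<longleftrightarrow>
     (\<exists>C>0. \<forall>R>0. \<forall>r\<in>{0<..<R}. \<forall>x\<in>F.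
        real (covering_number (cball x R \<inter> F) r) \<le> C * (R / r) powr \<sigma>)"

lemma assouad_dim_eqI:
  assumes "0 \<le> \<sigma>" and "assouad_exponent F \<sigma>"
    and "\<And>\<tau>. 0 \<le> \<tau> \<Longrightarrow> assouad_exponent F \<tau> \<Longrightarrow> \<sigma> \<le> \<tau>"
  shows "assouad_dim F = \<sigma>"
proof -
  have "assouad_dim F = Inf {\<tau>. \<tau> \<ge> 0 \<and> assouad_exponent F \<tau>}"
    by (simp add: assouad_dim_def assouad_exponent_def)
  also have "\<dots> = \<sigma>"
    by (rule cInf_eq_minimum) (use assms in auto)
  finally show ?thesis .
qed

lemma covering_number_le:
  assumes "finite \<U>" and "E \<subseteq> \<Union>\<U>"
    and "\<And>U. U \<in> \<U> \<Longrightarrow> open U \<and> bounded U \<and> diameter U \<le> r"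
  shows "covering_number E r \<le> card \<U>"
  unfolding covering_number_def by (rule Least_le) (use assms in blast)

lemma covering_number_attained:
  fixes E :: "'a::euclidean_space set"
  assumes "bounded E" and "0 < r"
  obtains \<U> where "finite \<U>" and "card \<U> = covering_number E r" and "E \<subseteq> \<Union>\<U>"
    and "\<And>U. U \<in> \<U> \<Longrightarrow> open U \<and> bounded U \<and> diameter U \<le> r"
proof -
  have "compact (closure E)" using assms by (simp add: compact_closure)
  then obtain A where A: "finite A" "closure E \<subseteq> (\<Union>x\<in>A. ball x (r/2))"
    using \<open>0 < r\<close> compact_eq_totally_bounded[of "closure E"] half_gt_zero by metis
  let ?P = "\<lambda>n. \<exists>\<U>. finite \<U> \<and> card \<U> = n \<and> E \<subseteq> \<Union>\<U> \<and>
                   (\<forall>U\<in>\<U>. open U \<and> bounded U \<and> diameter U \<le> r)"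
  have "?P (card ((\<lambda>x. ball x (r/2)) ` A))"
    using A closure_subset[of E] \<open>0 < r\<close>
    by (intro exI[of _ "(\<lambda>x. ball x (r/2)) ` A"]) (auto simp: diameter_ball)
  then have "?P (covering_number E r)"
    unfolding covering_number_def by (rule LeastI)
  then show ?thesis using that by blast
qed

lemma card_separated_le_covering_number:
  fixes E :: "'a::euclidean_space set"
  assumes "bounded E" and "0 < r" and "A \<subseteq> E"
    and separated: "\<And>x y. x \<in> A \<Longrightarrow> y \<in> A \<Longrightarrow> x \<noteq> y \<Longrightarrow> r < dist x y"
  shows "card A \<le> covering_number E r"
proof -
  obtain \<U> where \<U>: "finite \<U>" "card \<U> = covering_number E r" "E \<subseteq> \<Union>\<U>"
    "\<And>U. U \<in> \<U> \<Longrightarrow> open U \<and> bounded U \<and> diameter U \<le> r"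
    using covering_number_attained[OF assms(1,2)] by metis
  have "\<forall>x\<in>A. \<exists>U\<in>\<U>. x \<in> U" using \<U>(3) \<open>A \<subseteq> E\<close> by blast
  then obtain c where c: "\<And>x. x \<in> A \<Longrightarrow> c x \<in> \<U> \<and> x \<in> c x" by metis
  have "inj_on c A"
  proof (rule inj_onI, rule ccontr)
    fix x y assume xy: "x \<in> A" "y \<in> A" "c x = c y" "x \<noteq> y"
    then have "dist x y \<le> diameter (c x)"
      using c \<U>(4) by (metis diameter_bounded_bound)
    also have "\<dots> \<le> r" using c \<U>(4) xy(1) by blast
    finally show False using separated xy by fastforce
  qed
  then have "card A \<le> card \<U>"
    using c \<U>(1) by (intro card_inj_on_le[of c]) auto
  then show ?thesis using \<U>(2) by simp
qed

text \<open>
  Balls of the set lie over intervals of the line of comparable length, and the points lying over an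
  interval of length \<open>r / (3 c)\<close> are so close together that one open ball of diameter \<open>r\<close> holds them
  all. So an interval count on the line is enough.
\<close>
lemma bi_lipschitz_line_imp_assouad_exponent:
  fixes F :: "'a::euclidean_space set" and g :: "'a \<Rightarrow> real"
  assumes "0 < c"
    and upper: "\<And>x y. x \<in> F \<Longrightarrow> y \<in> F \<Longrightarrow> \<bar>g x - g y\<bar> \<le> c * dist x y"
    and lower: "\<And>x y. x \<in> F \<Longrightarrow> y \<in> F \<Longrightarrow> dist x y \<le> c * \<bar>g x - g y\<bar>"
  shows "assouad_exponent F 1"
proof -
  have "real (covering_number (cball x R \<inter> F) r) \<le> (6 * c\<^sup>2 + 3) * (R / r)"
    if "0 < r" "r < R" "x \<in> F" for x R r
  proof -
    define E where "E = cball x R \<inter> F"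
    define \<rho> where "\<rho> = r / (3 * c)"
    define cell where "cell y = \<lfloor>(g y - g x) / \<rho>\<rfloor>" for y
    define M where "M = \<lceil>c * R / \<rho>\<rceil>"
    have "\<rho> > 0" using that \<open>0 < c\<close> by (simp add: \<rho>_def)
    have "M \<ge> 0" unfolding M_def
      using \<open>\<rho> > 0\<close> that \<open>0 < c\<close> divide_nonneg_pos[of "c * R" \<rho>]
      by (simp add: order.strict_trans2[of "-1" 0])
    have cells: "cell ` E \<subseteq> {-M..M}"
    proof
      fix i assume "i \<in> cell ` E"
      then obtain y where y: "y \<in> E" "i = cell y" by blast
      have "\<bar>g y - g x\<bar> \<le> c * dist y x" using upper y that by (auto simp: E_def)
      also have "\<dots> \<le> c * R"
        using y \<open>0 < c\<close> by (auto simp: E_def dist_commute intro: mult_left_mono)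
      finally have "\<bar>(g y - g x) / \<rho>\<bar> \<le> c * R / \<rho>"
        using \<open>\<rho> > 0\<close> by (simp add: divide_right_mono)
      then have "\<bar>(g y - g x) / \<rho>\<bar> \<le> of_int M" unfolding M_def by linarith
      then show "i \<in> {-M..M}" using y(2) unfolding cell_def by (auto simp: le_floor_iff; linarith)
    qed
    let ?\<U> = "(\<lambda>i. ball (inv_into E cell i) (r/2)) ` cell ` E"
    have fin: "finite (cell ` E)" using cells finite_subset by blast
    have "covering_number E r \<le> card ?\<U>"
    proof (rule covering_number_le)
      show "E \<subseteq> \<Union>?\<U>"
      proof
        fix y assume y: "y \<in> E"
        define z where "z = inv_into E cell (cell y)"
        have z: "z \<in> E" "cell z = cell y"
          using y by (auto simp: z_def inv_into_into f_inv_into_f)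
        have "\<bar>(g z - g x) / \<rho> - (g y - g x) / \<rho>\<bar> < 1" using z(2) unfolding cell_def by linarith
        then have "\<bar>g z - g y\<bar> < \<rho>"
          using \<open>\<rho> > 0\<close> by (simp add: diff_divide_distrib[symmetric] abs_divide)
        have "dist z y \<le> c * \<bar>g z - g y\<bar>" using lower z(1) y by (auto simp: E_def)
        also have "\<dots> \<le> c * \<rho>" using \<open>\<bar>g z - g y\<bar> < \<rho>\<close> \<open>0 < c\<close> by simp
        also have "\<dots> < r / 2" using \<open>0 < c\<close> that by (simp add: \<rho>_def)
        finally show "y \<in> \<Union>?\<U>" using y unfolding z_def by auto
      qed
    qed (use fin that in \<open>auto simp: diameter_ball\<close>)
    also have "\<dots> \<le> card (cell ` E)" using fin by (rule card_image_le)
    also have "\<dots> \<le> card {-M..M}" using cells by (intro card_mono) auto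
    finally have "real (covering_number E r) \<le> 2 * real_of_int M + 1" using \<open>M \<ge> 0\<close> by auto
    also have "\<dots> \<le> 2 * (c * R / \<rho>) + 3" unfolding M_def by linarith
    \<comment> \<open>The additive constant is absorbed because \<open>1 \<le> R / r\<close>.\<close>
    also have "\<dots> \<le> (6 * c\<^sup>2 + 3) * (R / r)"
      using that \<open>0 < c\<close> by (simp add: \<rho>_def field_simps power2_eq_square)
    finally show ?thesis by (simp add: E_def)
  qed
  moreover have "6 * c\<^sup>2 + 3 > 0" by (simp add: add_nonneg_pos)
  ultimately show ?thesis unfolding assouad_exponent_def
    by (intro exI[of _ "6 * c\<^sup>2 + 3"]) auto
qed

text \<open>
  Equally spaced points show that a segment of length \<open>L\<close> needs at least \<open>n\<close> sets of diameter
  \<open>L / (2 n)\<close>, which is a linear growth in \<open>1 / r\<close>.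
\<close>
lemma segment_imp_assouad_exponent_ge_1:
  fixes F :: "'a::euclidean_space set"
  assumes segment: "closed_segment p q \<subseteq> F" and "p \<noteq> q"
    and exponent: "assouad_exponent F \<sigma>"
  shows "1 \<le> \<sigma>"
proof (rule ccontr)
  assume "\<not> 1 \<le> \<sigma>"
  define L where "L = dist p q"
  have "L > 0" using \<open>p \<noteq> q\<close> by (simp add: L_def)
  \<comment> \<open>For the ball of radius \<open>L\<close> about \<open>p\<close> and \<open>R / r = 2 n\<close> the bound reads
    \<open>n \<le> C (2 n) powr \<sigma>\<close>, which fails for large \<open>n\<close>.\<close>
  obtain C where C: "\<And>R r x. 0 < r \<Longrightarrow> r < R \<Longrightarrow> x \<in> F \<Longrightarrow>
      real (covering_number (cball x R \<inter> F) r) \<le> C * (R / r) powr \<sigma>"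
    using exponent unfolding assouad_exponent_def by (meson greaterThanLessThan_iff order.strict_trans)
  have "real n powr (1 - \<sigma>) \<le> C * 2 powr \<sigma>" if "n > 0" for n :: nat
  proof -
    define r where "r = L / (2 * real n)"
    define pt where "pt j = p + (real j / real n) *\<^sub>R (q - p)" for j :: nat
    have "r > 0" "r < L" using \<open>L > 0\<close> that by (auto simp: r_def field_simps)
    have dist_pt: "dist (pt i) (pt j) = \<bar>real i - real j\<bar> * (2 * r)" for i j
    proof -
      have "pt i - pt j = ((real i - real j) / real n) *\<^sub>R (q - p)"
        by (simp add: pt_def diff_divide_distrib scaleR_left_diff_distrib)
      then show ?thesis using that
        by (simp add: dist_norm r_def L_def norm_minus_commute abs_divide)
    qed
    have separated: "r < dist (pt i) (pt j)" if "i \<noteq> j" for i j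
    proof -
      have "1 \<le> \<bar>real i - real j\<bar>" using that by linarith
      then have "1 * (2 * r) \<le> dist (pt i) (pt j)"
        unfolding dist_pt using \<open>r > 0\<close> by (intro mult_right_mono) auto
      then show ?thesis using \<open>r > 0\<close> by simp
    qed
    then have "inj_on pt {..<n}"
      using \<open>r > 0\<close> by (intro inj_onI) (metis dist_self order.asym)
    then have "n = card (pt ` {..<n})" by (simp add: card_image)
    also have "\<dots> \<le> covering_number (cball p L \<inter> F) r"
    proof (rule card_separated_le_covering_number)
      show "pt ` {..<n} \<subseteq> cball p L \<inter> F"
      proof (intro subsetI)
        fix x assume "x \<in> pt ` {..<n}"
        then obtain j where j: "j < n" "x = pt j" by blast
        then have "x \<in> closed_segment p q"
          unfolding closed_segment_def
          by (auto simp: pt_def algebra_simps intro!: exI[of _ "real j / real n"])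
        moreover have "closed_segment p q \<subseteq> cball p L"
          by (rule closed_segment_subset) (auto simp: L_def)
        ultimately show "x \<in> cball p L \<inter> F" using segment by blast
      qed
      show "r < dist x y" if "x \<in> pt ` {..<n}" "y \<in> pt ` {..<n}" "x \<noteq> y" for x y
        using that by (elim imageE) (metis separated)
    qed (use \<open>r > 0\<close> in \<open>auto simp: bounded_Int\<close>)
    finally have "real n \<le> real (covering_number (cball p L \<inter> F) r)" by simp
    also have "\<dots> \<le> C * (L / r) powr \<sigma>"
      using C \<open>r > 0\<close> \<open>r < L\<close> segment by auto
    also have "\<dots> = C * 2 powr \<sigma> * real n powr \<sigma>"
      using \<open>L > 0\<close> by (simp add: r_def powr_mult)
    finally show ?thesis using that
      by (simp add: powr_diff divide_le_eq)
  qed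
  then have "\<forall>\<^sub>F n in sequentially. real n powr (1 - \<sigma>) \<le> C * 2 powr \<sigma>"
    by (intro eventually_sequentiallyI[of 1]) auto
  moreover have "filterlim (\<lambda>n. real n powr (1 - \<sigma>)) at_top sequentially"
    using \<open>\<not> 1 \<le> \<sigma>\<close> by real_asymp
  then have "\<forall>\<^sub>F n in sequentially. C * 2 powr \<sigma> < real n powr (1 - \<sigma>)"
    by (simp add: filterlim_at_top_dense)
  ultimately have "\<forall>\<^sub>F n::nat in sequentially. False"
    by eventually_elim simp
  then show False by simp
qed

section \<open>The comb\<close>

text \<open>
  An element \<open>(a, a v)\<close> describes the tooth with foot \<open>a u\<close> and direction \<open>v\<close>. The pair
  \<open>(0, 0)\<close> is the degenerate tooth at the origin; being the limit of the others, it makes the set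
  of teeth compact.
\<close>
definition teeth :: "(nat \<Rightarrow> 'a) \<Rightarrow> (real \<times> 'a::euclidean_space) set" where
  "teeth v = insert (0, 0) (range (\<lambda>n. ((1/2)^n, (1/2)^n *\<^sub>R v n)))"

definition comb :: "'a \<Rightarrow> (nat \<Rightarrow> 'a) \<Rightarrow> 'a::euclidean_space set" where
  "comb u v = (\<lambda>((a, y), s). a *\<^sub>R u + s *\<^sub>R y) ` (teeth v \<times> {0..1/6})"

lemma comb_iff: "x \<in> comb u v \<longleftrightarrow>
    (\<exists>a y s. (a, y) \<in> teeth v \<and> 0 \<le> s \<and> s \<le> 1/6 \<and> x = a *\<^sub>R u + s *\<^sub>R y)"
  by (force simp: comb_def)

lemma tooth_subset_comb:
  assumes "0 \<le> s" and "s \<le> 1/6"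
  shows "(1/2)^n *\<^sub>R u + (s * (1/2)^n) *\<^sub>R v n \<in> comb u v"
  unfolding comb_iff teeth_def
  by (rule exI[of _ "(1/2)^n"], rule exI[of _ "(1/2)^n *\<^sub>R v n"], rule exI[of _ s])
    (use assms in auto)

lemma compact_comb:
  assumes v: "\<And>n. norm (v n) = 1"
  shows "compact (comb u v)"
proof -
  have half: "(\<lambda>n. (1/2)^n :: real) \<longlonglongrightarrow> 0" by (simp add: LIMSEQ_power_zero)
  then have "(\<lambda>n. (1/2)^n *\<^sub>R v n) \<longlonglongrightarrow> 0"
    by (rule Lim_null_comparison[rotated]) (simp add: v)
  then have "compact (teeth v)"
    unfolding teeth_def by (intro compact_sequence_with_limit tendsto_Pair half)
  then show ?thesis unfolding comb_def
    by (intro compact_continuous_image compact_Times)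
      (auto simp: case_prod_unfold intro!: continuous_intros)
qed

lemma norm_tooth:
  assumes "\<And>n. norm (v n) = 1" and "(a, y) \<in> teeth v"
  shows "norm y = a"
  using assms by (auto simp: teeth_def)

lemma halving_power_separated:
  assumes "m \<noteq> n"
  shows "(1/2)^m + (1/2)^n \<le> 3 * \<bar>(1/2)^m - (1/2)^n :: real\<bar>"
proof -
  have "(1/2)^m + (1/2)^n \<le> 3 * \<bar>(1/2)^m - (1/2)^n :: real\<bar>" if "m < n" for m n :: nat
  proof -
    have half: "p + q \<le> 3 * \<bar>p - q\<bar>" if "q \<le> p / 2" for p q :: real
      using that by (simp add: abs_if)
    have "(1/2)^n \<le> (1/2::real)^Suc m" using that by (intro power_decreasing) auto
    then show ?thesis by (intro half) simp
  qed
  from this[of m n] this[of n m] assms show ?thesis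
    by (cases m n rule: linorder_cases) (auto simp: add.commute abs_minus_commute)
qed

lemma teeth_separated:
  assumes "(a, y) \<in> teeth v" and "(b, z) \<in> teeth v" and "(a, y) \<noteq> (b, z)"
  shows "a + b \<le> 3 * \<bar>a - b\<bar>"
proof -
  consider "a = 0" | "b = 0"
    | m n where "a = (1/2)^m" "y = a *\<^sub>R v m" "b = (1/2)^n" "z = b *\<^sub>R v n"
    using assms(1,2) unfolding teeth_def by blast
  then show ?thesis
  proof cases
    case 3
    then have "m \<noteq> n" using assms(3) by blast
    with 3 show ?thesis using halving_power_separated[of m n] by simp
  qed simp_all
qed

lemma norm_half_perturbation:
  fixes p q :: "'b::real_normed_vector"
  assumes "norm q \<le> norm p / 2"
  shows "norm p / 2 \<le> norm (p + q)" and "norm (p + q) \<le> 3 / 2 * norm p"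
  using assms norm_triangle_ineq[of p q] norm_diff_ineq[of p q] by simp_all

text \<open>
  Laying the teeth down on the ray sends the point \<open>a u + s y\<close> of the tooth \<open>(a, y)\<close> to the
  number \<open>a + s a\<close>. Within one tooth this is an isometry. For two teeth both distances differ
  from the distance \<open>\<bar>a - b\<bar>\<close> of the feet by at most the total length \<open>(a + b) / 6\<close> of the teeth,
  that is, by at most \<open>\<bar>a - b\<bar> / 2\<close>, so both lie between \<open>\<bar>a - b\<bar> / 2\<close> and \<open>3 \<bar>a - b\<bar> / 2\<close>.
\<close>
lemma laid_down_bi_lipschitz:
  fixes u :: "'a::euclidean_space"
  assumes u: "norm u = 1" and v: "\<And>n. norm (v n) = 1"
    and a: "(a, y) \<in> teeth v" and b: "(b, z) \<in> teeth v"
    and s: "0 \<le> s" "s \<le> 1/6" and t: "0 \<le> t" "t \<le> 1/6"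
  defines "D \<equiv> dist (a *\<^sub>R u + s *\<^sub>R y) (b *\<^sub>R u + t *\<^sub>R z)"
    and "\<delta> \<equiv> \<bar>(a + s * a) - (b + t * b)\<bar>"
  shows "\<delta> \<le> 3 * D" and "D \<le> 3 * \<delta>"
proof -
  have norms: "norm y = a" "norm z = b" using norm_tooth[of v, OF v a] norm_tooth[of v, OF v b] by auto
  then have "a \<ge> 0" "b \<ge> 0" by (metis norm_ge_zero)+
  have "\<delta> \<le> 3 * D \<and> D \<le> 3 * \<delta>"
  proof (cases "(a, y) = (b, z)")
    case True
    then have "D = norm ((s - t) *\<^sub>R y)"
      by (simp add: D_def dist_norm scaleR_left_diff_distrib)
    then have "D = \<bar>s - t\<bar> * a" using norms by simp
    also have "\<dots> = \<delta>"
      using True \<open>a \<ge> 0\<close> by (simp add: \<delta>_def left_diff_distrib[symmetric] abs_mult)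
    finally have "D = \<delta>" .
    moreover have "\<delta> \<ge> 0" by (simp add: \<delta>_def)
    ultimately show ?thesis by simp
  next
    case False
    have "s * a \<le> a / 6" "t * b \<le> b / 6"
      using mult_right_mono[OF s(2) \<open>a \<ge> 0\<close>] mult_right_mono[OF t(2) \<open>b \<ge> 0\<close>] by simp_all
    then have short: "s * a + t * b \<le> \<bar>a - b\<bar> / 2"
      using teeth_separated[OF a b False] by linarith
    have nonneg: "0 \<le> s * a" "0 \<le> t * b" using s t \<open>a \<ge> 0\<close> \<open>b \<ge> 0\<close> by simp_all
    have "norm (s *\<^sub>R y - t *\<^sub>R z) \<le> s * a + t * b"
      using norm_triangle_ineq4[of "s *\<^sub>R y" "t *\<^sub>R z"] s t norms by simp
    also have "\<dots> \<le> norm ((a - b) *\<^sub>R u) / 2" using short u by simp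
    finally have "norm (s *\<^sub>R y - t *\<^sub>R z) \<le> norm ((a - b) *\<^sub>R u) / 2" .
    moreover have "D = norm ((a - b) *\<^sub>R u + (s *\<^sub>R y - t *\<^sub>R z))"
      by (simp add: D_def dist_norm algebra_simps)
    ultimately have D: "\<bar>a - b\<bar> / 2 \<le> D" "D \<le> 3 / 2 * \<bar>a - b\<bar>"
      using norm_half_perturbation[of "s *\<^sub>R y - t *\<^sub>R z" "(a - b) *\<^sub>R u"] u by simp_all
    have "norm (s * a - t * b) \<le> norm (a - b) / 2"
      using short nonneg abs_triangle_ineq4[of "s * a" "t * b"] by simp
    moreover have "\<delta> = norm ((a - b) + (s * a - t * b))"
      by (simp add: \<delta>_def algebra_simps)
    ultimately have "\<bar>a - b\<bar> / 2 \<le> \<delta>" "\<delta> \<le> 3 / 2 * \<bar>a - b\<bar>"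
      using norm_half_perturbation[of "s * a - t * b" "a - b"] by simp_all
    with D show ?thesis by simp
  qed
  then show "\<delta> \<le> 3 * D" and "D \<le> 3 * \<delta>" by simp_all
qed

lemma assouad_dim_comb:
  fixes u :: "'a::euclidean_space"
  assumes u: "norm u = 1" and v: "\<And>n. norm (v n) = 1"
  shows "assouad_dim (comb u v) = 1"
proof (rule assouad_dim_eqI)
  define lies_at where "lies_at x h \<longleftrightarrow> (\<exists>a y s. (a, y) \<in> teeth v \<and> 0 \<le> s \<and> s \<le> 1/6 \<and>
      x = a *\<^sub>R u + s *\<^sub>R y \<and> h = a + s * a)" for x h
  have "\<exists>h. lies_at x h" if "x \<in> comb u v" for x
    using that unfolding comb_iff lies_at_def by metis
  then obtain g where g: "\<And>x. x \<in> comb u v \<Longrightarrow> lies_at x (g x)" by metis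
  have "\<bar>g x - g y\<bar> \<le> 3 * dist x y \<and> dist x y \<le> 3 * \<bar>g x - g y\<bar>"
    if xy: "x \<in> comb u v" "y \<in> comb u v" for x y
  proof -
    obtain a w s where x: "(a, w) \<in> teeth v" "0 \<le> s" "s \<le> 1/6"
      "x = a *\<^sub>R u + s *\<^sub>R w" "g x = a + s * a"
      using g[OF xy(1)] unfolding lies_at_def by metis
    obtain b z t where y: "(b, z) \<in> teeth v" "0 \<le> t" "t \<le> 1/6"
      "y = b *\<^sub>R u + t *\<^sub>R z" "g y = b + t * b"
      using g[OF xy(2)] unfolding lies_at_def by metis
    show ?thesis
      using laid_down_bi_lipschitz[of u v, OF u v x(1) y(1) x(2,3) y(2,3)]
      unfolding x(5) y(5) unfolding x(4) y(4) by (rule conjI)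
  qed
  then show "assouad_exponent (comb u v) 1"
    by (intro bi_lipschitz_line_imp_assouad_exponent[of 3 _ g]) auto
next
  fix \<tau> assume "assouad_exponent (comb u v) \<tau>"
  moreover have "closed_segment u (u + (1/6) *\<^sub>R v 0) \<subseteq> comb u v"
  proof
    fix x assume "x \<in> closed_segment u (u + (1/6) *\<^sub>R v 0)"
    then obtain t where t: "0 \<le> t" "t \<le> 1" "x = (1 - t) *\<^sub>R u + t *\<^sub>R (u + (1/6) *\<^sub>R v 0)"
      by (auto simp: closed_segment_def)
    then have "x = u + (t/6) *\<^sub>R v 0" by (simp add: algebra_simps)
    then show "x \<in> comb u v" using tooth_subset_comb[of "t/6" 0 u v] t by simp
  qed
  moreover have "u \<noteq> u + (1/6) *\<^sub>R v 0" using v[of 0] by auto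
  ultimately show "1 \<le> \<tau>" using segment_imp_assouad_exponent_ge_1 by metis
qed simp

section \<open>Progressions in the teeth\<close>

text \<open>
  The two progressions share their first point and their scale, so the \<open>j\<close>-th points differ by
  \<open>j \<Delta> (e - w)\<close>.
\<close>
lemma tilted_progression_is_patch:
  fixes e w :: "'a::euclidean_space"
  assumes "0 < \<Delta>" and "0 \<le> \<epsilon>" and "\<epsilon> < 1" and "e \<noteq> 0" and "w \<noteq> 0"
    and tilt: "real k * dist e w \<le> \<epsilon>"
  shows "approx_arithmetic_patch k \<epsilon> {e} ((\<lambda>j. t + (\<Delta> * real j) *\<^sub>R w) ` {..<k})"
    (is "approx_arithmetic_patch k \<epsilon> {e} ?Q")
proof -
  let ?P = "(\<lambda>j. t + (\<Delta> * real j) *\<^sub>R e) ` {..<k}"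
  have "?P = {t + \<Delta> *\<^sub>R (\<Sum>v\<in>{e}. real (x v) *\<^sub>R v) | x. \<forall>v\<in>{e}. x v < k}"
  proof (intro equalityI subsetI)
    fix p assume "p \<in> ?P"
    then obtain j where "j < k" "p = t + (\<Delta> * real j) *\<^sub>R e" by blast
    then show "p \<in> {t + \<Delta> *\<^sub>R (\<Sum>v\<in>{e}. real (x v) *\<^sub>R v) | x. \<forall>v\<in>{e}. x v < k}"
      by (auto intro!: exI[of _ "\<lambda>_. j"])
  qed auto
  then have "arithmetic_patch k \<Delta> {e} ?P"
    using assms unfolding arithmetic_patch_def by (auto simp: dependent_single)
  moreover have "inj_on (\<lambda>j. t + (\<Delta> * real j) *\<^sub>R e) {..<k}"
    "inj_on (\<lambda>j. t + (\<Delta> * real j) *\<^sub>R w) {..<k}"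
    using assms by (auto intro!: inj_onI)
  then have "card ?Q = card ?P" by (simp add: card_image)
  moreover have "(INF y\<in>?Q. norm (x - y)) \<le> \<epsilon> * \<Delta>" if x: "x \<in> ?P" for x
  proof -
    obtain j where j: "j < k" "x = t + (\<Delta> * real j) *\<^sub>R e" using x by blast
    have "(INF y\<in>?Q. norm (x - y)) \<le> norm (x - (t + (\<Delta> * real j) *\<^sub>R w))"
      by (rule cINF_lower) (use j in \<open>auto intro!: bdd_belowI2[of _ 0]\<close>)
    also have "\<dots> = norm ((\<Delta> * real j) *\<^sub>R (e - w))"
      by (simp add: j scaleR_right_diff_distrib)
    also have "\<dots> = \<Delta> * (real j * dist e w)"
      using \<open>0 < \<Delta>\<close> by (simp add: dist_norm)
    also have "\<dots> \<le> \<Delta> * (real k * dist e w)"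
      using j \<open>0 < \<Delta>\<close> by (intro mult_left_mono mult_right_mono) auto
    also have "\<dots> \<le> \<epsilon> * \<Delta>" using tilt \<open>0 < \<Delta>\<close> by simp
    finally show ?thesis .
  qed
  ultimately show ?thesis using assms unfolding approx_arithmetic_patch_def by blast
qed

lemma tooth_contains_patch:
  fixes u e :: "'a::euclidean_space"
  assumes "k > 0" and "0 \<le> \<epsilon>" and "\<epsilon> < 1" and "e \<noteq> 0" and "v n \<noteq> 0"
    and "real k * dist e (v n) \<le> \<epsilon>"
  shows "\<exists>Q. approx_arithmetic_patch k \<epsilon> {e} Q \<and> Q \<subseteq> comb u v"
proof -
  \<comment> \<open>The tooth has length \<open>(1/2)\<^sup>n / 6\<close>, which leaves room for \<open>k\<close> steps of this size.\<close>
  define \<Delta> where "\<Delta> = (1/2)^n / (6 * real k)"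
  let ?Q = "(\<lambda>j. (1/2)^n *\<^sub>R u + (\<Delta> * real j) *\<^sub>R v n) ` {..<k}"
  have "\<Delta> > 0" using \<open>k > 0\<close> by (simp add: \<Delta>_def)
  then have "approx_arithmetic_patch k \<epsilon> {e} ?Q"
    using assms by (intro tilted_progression_is_patch) auto
  moreover have "?Q \<subseteq> comb u v"
  proof
    fix x assume "x \<in> ?Q"
    then obtain j where j: "j < k" "x = (1/2)^n *\<^sub>R u + (\<Delta> * real j) *\<^sub>R v n" by blast
    have "\<Delta> * real j = (real j / (6 * real k)) * (1/2)^n" by (simp add: \<Delta>_def)
    moreover have "real j / (6 * real k) \<le> 1/6" using j(1) by (simp add: divide_simps)
    ultimately show "x \<in> comb u v"
      using tooth_subset_comb[of "real j / (6 * real k)" n u v] j(2) by simp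
  qed
  ultimately show ?thesis by blast
qed

lemma dense_sequence_in_sphere:
  obtains v :: "nat \<Rightarrow> 'a::euclidean_space"
  where "\<And>n. norm (v n) = 1"
    and "\<And>e \<eta>. norm e = 1 \<Longrightarrow> 0 < \<eta> \<Longrightarrow> \<exists>n. dist e (v n) < \<eta>"
proof -
  obtain T :: "'a set" where T: "countable T" "T \<subseteq> sphere 0 1" "sphere 0 1 \<subseteq> closure T"
    using separable by metis
  have "sphere (0::'a) 1 \<noteq> {}" by simp
  then have "T \<noteq> {}" using T(3) by auto
  then have range: "range (from_nat_into T) = T" using T(1) by (simp add: range_from_nat_into)
  show ?thesis
  proof
    show "norm (from_nat_into T n) = 1" for n
      using from_nat_into[OF \<open>T \<noteq> {}\<close>, of n] T(2) by auto
    fix e :: 'a and \<eta> :: real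
    assume "norm e = 1" "0 < \<eta>"
    then have "e \<in> closure T" using T(3) by auto
    then obtain y where "y \<in> T" "dist y e < \<eta>"
      using \<open>0 < \<eta>\<close> by (auto simp: closure_approachable)
    then show "\<exists>n. dist e (from_nat_into T n) < \<eta>"
      using range by (metis dist_commute rangeE)
  qed
qed

theorem theorem2p1:
  assumes "CARD('d::finite) \<ge> 2"
  shows "\<exists>K :: (real ^ 'd) set.
           compact K \<and>
           (\<forall>k::nat. \<forall>\<epsilon>::real. \<forall>e. k \<ge> 3 \<longrightarrow> 0 < \<epsilon> \<longrightarrow> \<epsilon> < 1 \<longrightarrow> e \<in> sphere 0 1 \<longrightarrow>
              (\<exists>Q. approx_arithmetic_patch k \<epsilon> {e} Q \<and> Q \<subseteq> K)) \<and>
           assouad_dim K = 1"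
proof -
  obtain v :: "nat \<Rightarrow> real ^ 'd" where v: "\<And>n. norm (v n) = 1"
    and dense: "\<And>e \<eta>. norm e = 1 \<Longrightarrow> 0 < \<eta> \<Longrightarrow> \<exists>n. dist e (v n) < \<eta>"
    using dense_sequence_in_sphere by metis
  define u where "u = v 0"
  have "\<exists>Q. approx_arithmetic_patch k \<epsilon> {e} Q \<and> Q \<subseteq> comb u v"
    if k: "k \<ge> 3" and \<epsilon>: "0 < \<epsilon>" "\<epsilon> < 1" and e: "e \<in> sphere 0 1" for k :: nat and \<epsilon> :: real and e
  proof -
    obtain n where "dist e (v n) < \<epsilon> / real k"
      using dense[of e "\<epsilon> / real k"] k \<epsilon> e by auto
    then have "real k * dist e (v n) \<le> \<epsilon>" using k by (simp add: field_simps)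
    moreover have "e \<noteq> 0" "v n \<noteq> 0" using e v[of n] by auto
    ultimately show ?thesis using k \<epsilon> by (intro tooth_contains_patch[of k \<epsilon> e v n]) auto
  qed
  then show ?thesis
    using compact_comb[of v u] assouad_dim_comb[of u v] v by (auto simp: u_def)
qed

end
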